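(* Let $(\mathcal{R},\boxplus,\boxtimes,\zeta)$ be a proximal ring and let $\mathcal{F}$ be a closed subset of $\mathcal{R}$. Then for every $\varepsilon\in\mathcal{R}$ the set $\varepsilon\boxminus\mathcal{F}=\{\varepsilon\boxplus(-f) : f\in\mathcal{F}\}$ is also closed.
   Context: A ring is associative, not necessarily commutative or unital; $\boxplus$ is its addition and $\boxtimes$ its multiplication. A proximity space $(\mathfrak{X},\zeta)$ is a nonempty set $\mathfrak{X}$ with a (Čech) proximity: a relation $\zeta$ on subsets of $\mathfrak{X}$ ("near") such that, for all $A,B,C\subseteq\mathfrak{X}$: $A\,\zeta\,B$ implies $B\,\zeta\,A$; $A\,\zeta\,B$ implies $A,B\neq\emptyset$; $A\cap B\neq\emptyset$ implies $A\,\zeta\,B$; and $A\,\zeta\,(B\cup C)$ if and only if $A\,\zeta\,B$ or $A\,\zeta\,C$. The closure of $A\subseteq\mathfrak{X}$ is $\mathrm{cl}_\zeta(A)=\{x\in\mathfrak{X} : \{x\}\,\zeta\,A\}$, and $A$ is closed if $\mathrm{cl}_\zeta(A)=A$. A map $f$ between proximity spaces is proximally continuous if $W$ near $K$ implies $f(W)$ near $f(K)$ for all subsets $W,K$ of its domain. The product of two proximity spaces carries the product proximity: $A$ is near $B$ if and only if for all finite decompositions $A=A_1\cup\dots\cup A_m$ and $B=B_1\cup\dots\cup B_n$ there are $i,j$ such that, for each coordinate projection $p$, $p(A_i)$ is near $p(B_j)$. (On rectangles: $W_1\times W_2$ is near $K_1\times K_2$ if and only if $W_1$ is near $K_1$ and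 $W_2$ is near $K_2$.) A proximal ring $(\mathcal{R},\boxplus,\boxtimes,\zeta)$ is a ring with a proximity $\zeta$ such that addition $(w_0,w_1)\mapsto w_0\boxplus w_1$ and multiplication $(w_0,w_1)\mapsto w_0\boxtimes w_1$, as maps $\mathcal{R}\times\mathcal{R}\to\mathcal{R}$, and additive inversion $w\mapsto -w$, as a map $\mathcal{R}\to\mathcal{R}$, are proximally continuous. *)

theory Defs
  imports Main
begin

text \<open>A proximity space is a type together with a Cech proximity \<open>near\<close> on all its subsets;
  nonemptiness is automatic since types are nonempty. The separation and strong axioms of
  Efremovich proximities are deliberately not required.\<close>

locale proximity_space =
  fixes near :: "'a set \<Rightarrow> 'a set \<Rightarrow> bool"
  assumes near_sym: "near A B \<Longrightarrow> near B A"
    and near_nonempty: "near A B \<Longrightarrow> A \<noteq> {} \<and> B \<noteq> {}"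
    and near_if_meet: "A \<inter> B \<noteq> {} \<Longrightarrow> near A B"
    and near_Un_iff: "near A (B \<union> C) \<longleftrightarrow> near A B \<or> near A C"

definition prox_closure :: "('a set \<Rightarrow> 'a set \<Rightarrow> bool) \<Rightarrow> 'a set \<Rightarrow> 'a set" where
  "prox_closure near A = {x. near {x} A}"

definition prox_closed :: "('a set \<Rightarrow> 'a set \<Rightarrow> bool) \<Rightarrow> 'a set \<Rightarrow> bool" where
  "prox_closed near A \<longleftrightarrow> prox_closure near A = A"

definition prox_continuous ::
    "('a set \<Rightarrow> 'a set \<Rightarrow> bool) \<Rightarrow> ('b set \<Rightarrow> 'b set \<Rightarrow> bool) \<Rightarrow> ('a \<Rightarrow> 'b) \<Rightarrow> bool" where
  "prox_continuous near1 near2 f \<longleftrightarrow> (\<forall>W K. near1 W K \<longrightarrow> near2 (f ` W) (f ` K))"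

text \<open>A finite decomposition of \<open>A\<close> is a finite family of sets with union \<open>A\<close>; the pieces need
  not be disjoint, and they need not be rectangles. Repeated pieces are irrelevant, so a set of sets
  is used in place of an indexed family. The empty family only decomposes the empty set, which is
  near nothing anyway.\<close>

definition prod_near ::
    "('a set \<Rightarrow> 'a set \<Rightarrow> bool) \<Rightarrow> ('b set \<Rightarrow> 'b set \<Rightarrow> bool)
      \<Rightarrow> ('a \<times> 'b) set \<Rightarrow> ('a \<times> 'b) set \<Rightarrow> bool" where
  "prod_near near1 near2 A B \<longleftrightarrow>
    (\<forall>\<A> \<B>. finite \<A> \<and> \<Union>\<A> = A \<and> finite \<B> \<and> \<Union>\<B> = B \<longrightarrow>
      (\<exists>A'\<in>\<A>. \<exists>B'\<in>\<B>. near1 (fst ` A') (fst ` B') \<and> near2 (snd ` A') (snd ` B')))"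

text \<open>The class \<open>ring\<close> is that of associative rings, neither commutative nor unital in general.\<close>

locale proximal_ring = proximity_space near
  for near :: "'a::ring set \<Rightarrow> 'a set \<Rightarrow> bool" +
  assumes continuous_add: "prox_continuous (prod_near near near) near (\<lambda>(x, y). x + y)"
    and continuous_mult: "prox_continuous (prod_near near near) near (\<lambda>(x, y). x * y)"
    and continuous_minus: "prox_continuous near near (\<lambda>x. - x)"

end

theory Submission
  imports Defs
begin

text \<open>The map \<open>g x = \<epsilon> - x\<close> is an involution, because addition is commutative, so the set
  \<open>\<epsilon> - F\<close> is not only the image but also the preimage of \<open>F\<close> under \<open>g\<close>. Preimages of closed sets
  under proximally continuous maps are closed (\<open>prox_closed_vimage\<close>), hence it remains to see that
  \<open>g\<close> is proximally continuous. It is inversion, followed by the inclusion \<open>y \<mapsto> (\<epsilon>, y)\<close> of a slice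
  into the product, followed by addition. The first and the last map are continuous in a proximal
  ring; the continuity of the inclusion (\<open>prox_continuous_slice\<close>) is where the definition of the
  product proximity enters.\<close>

context proximity_space
begin

lemma near_mono_right:
  assumes "near A B" and "B \<subseteq> C"
  shows "near A C"
  using assms near_Un_iff[of A B C] by (simp add: Un_absorb1)

lemma near_Union_right:
  assumes "finite \<B>" and "near A (\<Union>\<B>)"
  shows "\<exists>B\<in>\<B>. near A B"
  using assms
proof (induction \<B> rule: finite_induct)
  case empty
  then show ?case using near_nonempty by fastforce
next
  case (insert B \<B>)
  then show ?case by (auto simp: near_Un_iff)
qed

lemma near_Union_Union:
  assumes "finite \<A>" and "finite \<B>" and "near (\<Union>\<A>) (\<Union>\<B>)"
  shows "\<exists>A\<in>\<A>. \<exists>B\<in>\<B>. near A B"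
proof -
  obtain B where B: "B \<in> \<B>" "near (\<Union>\<A>) B"
    using near_Union_right assms(2,3) by blast
  obtain A where "A \<in> \<A>" "near B A"
    using near_Union_right[OF assms(1) near_sym[OF B(2)]] by blast
  then show ?thesis using B(1) near_sym by blast
qed

text \<open>A point of a set is always near it, so closedness only forbids further points near the set.\<close>

lemma prox_closed_iff: "prox_closed near A \<longleftrightarrow> (\<forall>x. near {x} A \<longrightarrow> x \<in> A)"
  unfolding prox_closed_def prox_closure_def using near_if_meet by blast

end

lemma prox_continuous_comp:
  assumes "prox_continuous near1 near2 f" and "prox_continuous near2 near3 g"
  shows "prox_continuous near1 near3 (g \<circ> f)"
  using assms unfolding prox_continuous_def by (simp only: image_comp[symmetric]) blast

lemma prox_closed_vimage:
  assumes "proximity_space near1" and "proximity_space near2"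
    and cont: "prox_continuous near1 near2 f" and closed: "prox_closed near2 F"
  shows "prox_closed near1 (f -` F)"
proof -
  interpret X: proximity_space near1 by fact
  interpret Y: proximity_space near2 by fact
  have "f x \<in> F" if "near1 {x} (f -` F)" for x
  proof -
    have "near2 {f x} (f ` (f -` F))"
      using cont that unfolding prox_continuous_def by fastforce
    then have "near2 {f x} F"
      by (rule Y.near_mono_right) auto
    then show ?thesis
      using closed unfolding Y.prox_closed_iff by blast
  qed
  then show ?thesis by (simp add: X.prox_closed_iff)
qed

text \<open>Finite decompositions of \<open>{a} \<times> W\<close> and \<open>{a} \<times> K\<close> project to finite decompositions of \<open>W\<close> and
  \<open>K\<close>, and nearness of \<open>W\<close> and \<open>K\<close> passes to some pair of pieces of these. That pair is nonempty,
  so in the first coordinate both of its members project to \<open>{a}\<close>, which is near itself.\<close>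

lemma prox_continuous_slice:
  fixes near1 :: "'a set \<Rightarrow> 'a set \<Rightarrow> bool" and near2 :: "'b set \<Rightarrow> 'b set \<Rightarrow> bool"
  assumes "proximity_space near1" and "proximity_space near2"
  shows "prox_continuous near2 (prod_near near1 near2) (Pair a)"
  unfolding prox_continuous_def prod_near_def
proof (intro allI impI, elim conjE)
  fix W K \<A> \<B>
  assume near: "near2 W K"
    and \<A>: "finite \<A>" "\<Union>\<A> = Pair a ` W" and \<B>: "finite \<B>" "\<Union>\<B> = Pair a ` K"
  interpret X: proximity_space near1 by fact
  interpret Y: proximity_space near2 by fact
  have "\<Union>((`) snd ` \<A>) = W" "\<Union>((`) snd ` \<B>) = K"
    unfolding image_Union[symmetric] \<A>(2) \<B>(2) by (simp_all add: image_comp comp_def)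
  then obtain A B where A: "A \<in> \<A>" and B: "B \<in> \<B>" and AB: "near2 (snd ` A) (snd ` B)"
    using Y.near_Union_Union[of "(`) snd ` \<A>" "(`) snd ` \<B>"] near \<A>(1) \<B>(1) by auto
  have fst_slice: "fst ` C = {a}" if "C \<noteq> {}" and "C \<subseteq> Pair a ` V" for C and V :: "'b set"
  proof -
    have "fst ` C \<subseteq> {a}" using that(2) by auto
    then show ?thesis using that(1) by (simp add: subset_singleton_iff)
  qed
  have "A \<noteq> {}" "B \<noteq> {}"
    using Y.near_nonempty[OF AB] by auto
  moreover have "A \<subseteq> Pair a ` W" "B \<subseteq> Pair a ` K"
    using A B \<A>(2) \<B>(2) by blast+
  ultimately have "fst ` A = {a}" "fst ` B = {a}"
    by (simp_all add: fst_slice)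
  then have "near1 (fst ` A) (fst ` B)"
    by (simp add: X.near_if_meet)
  then show "\<exists>A'\<in>\<A>. \<exists>B'\<in>\<B>. near1 (fst ` A') (fst ` B') \<and> near2 (snd ` A') (snd ` B')"
    using A B AB by blast
qed

lemma (in proximal_ring) prox_continuous_diff_left: "prox_continuous near near (\<lambda>x. a - x)"
proof -
  have "prox_continuous near near ((\<lambda>(x, y). x + y) \<circ> (Pair a \<circ> uminus))"
    using prox_continuous_slice[OF proximity_space_axioms proximity_space_axioms]
      continuous_minus continuous_add
    by (blast intro: prox_continuous_comp)
  then show ?thesis by (simp add: comp_def)
qed

theorem corollary2:
  fixes \<zeta> :: "'a::ring set \<Rightarrow> 'a set \<Rightarrow> bool" and F :: "'a set" and \<epsilon> :: 'a
  assumes "proximal_ring \<zeta>" and "prox_closed \<zeta> F"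
  shows "prox_closed \<zeta> {\<epsilon> + (- f) | f. f \<in> F}"
proof -
  interpret proximal_ring \<zeta> by fact
  have "x \<in> {\<epsilon> + (- f) | f. f \<in> F} \<longleftrightarrow> \<epsilon> - x \<in> F" for x
  proof
    assume "\<epsilon> - x \<in> F"
    moreover have "x = \<epsilon> + - (\<epsilon> - x)" by simp
    ultimately show "x \<in> {\<epsilon> + (- f) | f. f \<in> F}" by blast
  qed auto
  then have "{\<epsilon> + (- f) | f. f \<in> F} = (\<lambda>x. \<epsilon> - x) -` F"
    by blast
  then show ?thesis
    using prox_closed_vimage[OF proximity_space_axioms proximity_space_axioms
        prox_continuous_diff_left assms(2)] by simp
qed

end
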